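(* A Sturmian word $x\in\{0,1\}^{\mathbb{N}}$ is self-shuffling if and only if $\rho(x)\neq 0$, or equivalently, if and only if $x$ is not of the form $aC$ where $a\in\{0,1\}$ and $C$ is a characteristic Sturmian word.
   Context: An infinite word $x$ over a finite alphabet $\mathbb{A}$ is self-shuffling if there exist finite words $U_i,V_i\in\mathbb{A}^*$ (possibly empty, $i\ge 0$) with $x=\prod_{i=0}^\infty U_iV_i=\prod_{i=0}^\infty U_i=\prod_{i=0}^\infty V_i$. Sturmian words: let $0<\alpha<1$ be irrational and let the circle $\mathbb{R}/\mathbb{Z}$ be partitioned into an interval of length $1-\alpha$ between $0$ and $1-\alpha$ (labeled $0$) and an interval of length $\alpha$ between $1-\alpha$ and $1$ (labeled $1$). A Sturmian word of slope $\alpha$ and intercept $\rho\in[0,1)$ is a word $x=x_0x_1x_2\cdots\in\{0,1\}^{\mathbb{N}}$ such that $x_n$ is the label of the interval containing $\rho+n\alpha \bmod 1$ for all $n\ge0$, where the partition is taken either as $[0,1-\alpha),[1-\alpha,1)$ or as $(0,1-\alpha],(1-\alpha,1]$ (with $0$ identified with $1$ in the latter case). The intercept is denoted $\rho(x)$. A Sturmian word $C$ of slope $\alpha$ with $\rho(C)=\alpha$ is called a characteristic Sturmian word (of slope $\alpha$); $0C$ and $1C$ are then the two Sturmian words of slope $\alpha$ with intercept $0$. *)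

theory Defs
  imports Complex_Main "HOL-Library.Omega_Words_Fun"
begin

text \<open>
  The infinite product of a sequence of possibly empty finite words \<open>U 0, U 1, \<dots>\<close> equals the
  infinite word \<open>x\<close>: all finite partial products are prefixes of \<open>x\<close>, and their lengths are
  unbounded (otherwise the product would be a finite word).
\<close>

definition has_inf_product :: "(nat \<Rightarrow> 'a list) \<Rightarrow> 'a word \<Rightarrow> bool" where
  "has_inf_product U x \<longleftrightarrow>
     (\<forall>n. \<exists>y. x = concat (map U [0..<n]) \<frown> y) \<and>
     (\<forall>m. \<exists>n. m \<le> length (concat (map U [0..<n])))"

text \<open>
  The alphabet need not be mentioned: every letter of \<open>U i\<close> and \<open>V i\<close> occurs in \<open>x\<close>.
\<close>

definition self_shuffling :: "'a word \<Rightarrow> bool" where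
  "self_shuffling x \<longleftrightarrow>
     (\<exists>U V. has_inf_product (\<lambda>i. U i @ V i) x \<and> has_inf_product U x \<and> has_inf_product V x)"

text \<open>
  Points of the circle are represented by \<open>frac\<close>, i.e. in \<open>[0, 1)\<close>. For the second
  partition \<open>(0, 1 - \<alpha>], (1 - \<alpha>, 1]\<close> the point 0 is the point 1 of the interval labelled 1;
  accordingly \<open>frac t = 0\<close> falls into the \<open>else\<close> branch there.
\<close>

definition sturmian_word :: "real \<Rightarrow> real \<Rightarrow> nat word \<Rightarrow> bool" where
  "sturmian_word \<alpha> \<rho> x \<longleftrightarrow>
     0 < \<alpha> \<and> \<alpha> < 1 \<and> \<alpha> \<notin> \<rat> \<and> 0 \<le> \<rho> \<and> \<rho> < 1 \<and>
     ((\<forall>n. x n = (if frac (\<rho> + real n * \<alpha>) \<in> {0..<1 - \<alpha>} then 0 else 1)) \<or>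
      (\<forall>n. x n = (if frac (\<rho> + real n * \<alpha>) \<in> {0<..1 - \<alpha>} then 0 else 1)))"

definition characteristic_word :: "nat word \<Rightarrow> bool" where
  "characteristic_word C \<longleftrightarrow> (\<exists>\<alpha>. sturmian_word \<alpha> \<alpha> C)"

end

theory Submission
  imports Defs "HOL-Analysis.Kronecker_Approximation_Theorem"
begin

text \<open>
  A self-shuffling of \<open>x\<close> is an interleaving of two copies of \<open>x\<close> that spells \<open>x\<close>. When the two
  copies have been read up to positions \<open>i\<close> and \<open>j\<close>, the prefix of length \<open>i + j\<close> of \<open>x\<close> contains as
  many ones as the prefixes of lengths \<open>i\<close> and \<open>j\<close> together. For a Sturmian word the number of ones
  in the prefix of length \<open>n\<close> is the integer part of \<open>\<rho> + n\<alpha>\<close>, up to the choice of rounding at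
  integers, so questions about shuffles become inequalities between integer parts.

  \<^bold>\<open>Intercept 0 is an obstruction.\<close> With lower rounding the counting function is \<open>\<lfloor>n\<alpha>\<rfloor>\<close>, and additivity
  at \<open>(i, j)\<close> means that the fractional parts of \<open>i\<alpha>\<close> and \<open>j\<alpha>\<close> have sum less than 1. There are
  arbitrarily large \<open>q\<close> for which \<open>q\<alpha>\<close> is at least as close to the next integer as any \<open>n\<alpha>\<close>,
  \<open>0 < n \<le> q\<close>, is to the preceding one (\<open>frac_multiple_records\<close>); whichever copy reaches position
  \<open>q\<close> earlier, the other one then stands at such an \<open>n\<close>, and additivity fails
  (\<open>not_self_shuffling_coding_0\<close>). Upper rounding reduces to this case by exchanging the letters.

  \<^bold>\<open>Intercepts in the middle are easy.\<close> If \<open>\<alpha> \<le> \<rho> \<le> 1 - \<alpha>\<close>, ones are isolated, and one may simply let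
  the two copies take turns in supplying the ones. The numbers of zeros that the copies have to
  supply in between are then forced, and the bounds on \<open>\<rho>\<close> ensure that these numbers never
  exceed what the copies have at that point (\<open>self_shuffling_coding_middle\<close>).

  \<^bold>\<open>Other nonzero intercepts are zoomed to the middle.\<close> The image of a self-shuffling word under a
  substitution without empty images is self-shuffling. If \<open>\<rho>\<close> is close to 0, the word is the image of a
  Sturmian word whose intercept is \<open>\<rho>\<close> divided by \<open>max \<alpha> (1 - \<alpha>)\<close>: restrict the rotation to the longer
  of its two arcs, taken to start at 0. The intercept thus grows at least geometrically, and it
  cannot jump over the middle (\<open>self_shuffling_coding_by_zooming\<close>). If \<open>\<rho>\<close> is close to 1, exchange the
  letters, which replaces \<open>\<alpha>\<close> and \<open>\<rho>\<close> by \<open>1 - \<alpha>\<close> and \<open>1 - \<rho>\<close>.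

  The second description of the exceptional words holds because a Sturmian word determines its
  slope by the frequency of ones, and its intercept by density of the multiples of \<open>\<alpha>\<close> modulo 1.
\<close>

section \<open>Cutting infinite words\<close>

lemma concat_map_cuts:
  fixes x :: "'a word"
  assumes "c 0 = (0::nat)" "mono c"
  shows "concat (map (\<lambda>n. map x [c n..<c (Suc n)]) [0..<n]) = map x [0..<c n]"
proof (induction n)
  case 0
  then show ?case using assms by simp
next
  case (Suc n)
  have "c n \<le> c (Suc n)" using assms(2) by (simp add: monoD)
  then have "[0..<c (Suc n)] = [0..<c n] @ [c n..<c (Suc n)]"
    by (metis le_add_diff_inverse upt_add_eq_append zero_le)
  then show ?case using Suc by simp
qed

lemma has_inf_product_cuts:
  fixes x :: "'a word"
  assumes "c 0 = (0::nat)" "strict_mono c" and U: "\<And>n. U n = map x [c n..<c (Suc n)]"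
  shows "has_inf_product U x"
proof -
  have U': "U = (\<lambda>n. map x [c n..<c (Suc n)])" using U by auto
  have eq: "concat (map U [0..<n]) = map x [0..<c n]" for n
    unfolding U' using concat_map_cuts[of c x n] assms strict_mono_mono by blast
  have "x = map x [0..<c n] \<frown> suffix (c n) x" for n
    using prefix_suffix[of x "c n"] by (simp add: subsequence_def)
  moreover have "m \<le> c m" for m
    using assms(2) by (simp add: strict_mono_imp_increasing)
  ultimately show ?thesis
    unfolding has_inf_product_def eq by fastforce
qed

lemma has_inf_product_prefix:
  assumes "has_inf_product U x"
  shows "concat (map U [0..<n]) = map x [0..<length (concat (map U [0..<n]))]"
proof -
  obtain y where "x = concat (map U [0..<n]) \<frown> y"
    using assms unfolding has_inf_product_def by blast
  then show ?thesis
    by (intro nth_equalityI) (auto simp: conc_def)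
qed

text \<open>
  The factors of a shuffle are given by cutting both copies of \<open>x\<close>: the \<open>n\<close>-th step advances the
  first copy from \<open>a n\<close> to \<open>a (Suc n)\<close> while the second one waits at \<open>b n\<close>, and then the second copy
  while the first one waits at \<open>a (Suc n)\<close>.
\<close>

lemma self_shufflingI:
  fixes x :: "'a word"
  assumes "a 0 = (0::nat)" "b 0 = (0::nat)" "strict_mono a" "strict_mono b"
    and xa: "\<And>n i. a n \<le> i \<Longrightarrow> i < a (Suc n) \<Longrightarrow> x (i + b n) = x i"
    and xb: "\<And>n j. b n \<le> j \<Longrightarrow> j < b (Suc n) \<Longrightarrow> x (j + a (Suc n)) = x j"
  shows "self_shuffling x"
proof -
  define U where "U = (\<lambda>n. map x [a n..<a (Suc n)])"
  define V where "V = (\<lambda>n. map x [b n..<b (Suc n)])"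
  have shift: "map x [k..<l] = map x [k + d..<l + d]"
    if "\<And>i. k \<le> i \<Longrightarrow> i < l \<Longrightarrow> x (i + d) = x i" for k l d
  proof (rule nth_equalityI)
    fix i assume "i < length (map x [k..<l])"
    then show "map x [k..<l] ! i = map x [k + d..<l + d] ! i"
      using that[of "k + i"] by (simp add: ac_simps)
  qed simp
  have "U n @ V n = map x [a n + b n..<a (Suc n) + b (Suc n)]" for n
  proof -
    have U: "U n = map x [a n + b n..<a (Suc n) + b n]"
      unfolding U_def by (rule shift) (rule xa)
    have "V n = map x [b n + a (Suc n)..<b (Suc n) + a (Suc n)]"
      unfolding V_def by (rule shift) (rule xb)
    then have V: "V n = map x [a (Suc n) + b n..<a (Suc n) + b (Suc n)]"
      by (simp only: add.commute)
    have "a n + b n \<le> a (Suc n) + b n" "a (Suc n) + b n \<le> a (Suc n) + b (Suc n)"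
      using assms(3,4) by (simp_all add: strict_mono_less_eq)
    then have "[a n + b n..<a (Suc n) + b (Suc n)]
        = [a n + b n..<a (Suc n) + b n] @ [a (Suc n) + b n..<a (Suc n) + b (Suc n)]"
      by (metis le_add_diff_inverse upt_add_eq_append)
    then show ?thesis unfolding U V by simp
  qed
  moreover have "strict_mono (\<lambda>n. a n + b n)"
    using assms(3,4) by (simp add: strict_mono_def add_strict_mono)
  ultimately have "has_inf_product (\<lambda>n. U n @ V n) x"
    by (intro has_inf_product_cuts[where c = "\<lambda>n. a n + b n"]) (simp_all add: assms(1,2))
  moreover have "has_inf_product U x"
    by (rule has_inf_product_cuts[OF assms(1,3)]) (simp add: U_def)
  moreover have "has_inf_product V x"
    by (rule has_inf_product_cuts[OF assms(2,4)]) (simp add: V_def)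
  ultimately show ?thesis unfolding self_shuffling_def by blast
qed

section \<open>Substitutions\<close>

text \<open>
  That \<open>x\<close> is the image of \<open>y\<close> under the substitution \<open>\<tau>\<close> is expressed as the infinite product of
  the words \<open>\<tau> (y n)\<close> being \<open>x\<close>. Excluding empty images keeps the products infinite.
\<close>

lemma has_inf_product_substitution:
  assumes U: "has_inf_product U y" and x: "has_inf_product (\<lambda>n. \<tau> (y n)) x"
    and ne: "\<And>a. \<tau> a \<noteq> []"
  shows "has_inf_product (\<lambda>i. concat (map \<tau> (U i))) x"
proof -
  have eq: "concat (map (\<lambda>i. concat (map \<tau> (U i))) [0..<n])
      = concat (map (\<lambda>n. \<tau> (y n)) [0..<length (concat (map U [0..<n]))])" for n
  proof -
    have "concat (map (\<lambda>i. concat (map \<tau> (U i))) [0..<n]) = concat (map \<tau> (concat (map U [0..<n])))"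
      by (induction n) auto
    also have "\<dots> = concat (map \<tau> (map y [0..<length (concat (map U [0..<n]))]))"
      using has_inf_product_prefix[OF U, of n] by simp
    finally show ?thesis by (simp add: comp_def)
  qed
  have len: "k \<le> length (concat (map (\<lambda>n. \<tau> (y n)) [0..<k]))" for k
  proof (induction k)
    case (Suc k)
    have "length (\<tau> (y k)) \<ge> 1" using ne[of "y k"] by (cases "\<tau> (y k)") auto
    then show ?case using Suc by simp
  qed simp
  show ?thesis
    unfolding has_inf_product_def
  proof (intro conjI allI)
    fix n
    show "\<exists>z. x = concat (map (\<lambda>i. concat (map \<tau> (U i))) [0..<n]) \<frown> z"
      unfolding eq using x unfolding has_inf_product_def by blast
  next
    fix m
    obtain n where "m \<le> length (concat (map U [0..<n]))"
      using U unfolding has_inf_product_def by blast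
    then show "\<exists>n. m \<le> length (concat (map (\<lambda>i. concat (map \<tau> (U i))) [0..<n]))"
      unfolding eq using len le_trans by blast
  qed
qed

lemma self_shuffling_substitution:
  assumes "self_shuffling y" and x: "has_inf_product (\<lambda>n. \<tau> (y n)) x"
    and ne: "\<And>a. \<tau> a \<noteq> []"
  shows "self_shuffling x"
proof -
  obtain U V where "has_inf_product (\<lambda>i. U i @ V i) y" "has_inf_product U y" "has_inf_product V y"
    using assms(1) unfolding self_shuffling_def by blast
  from this[THEN has_inf_product_substitution, OF x ne] show ?thesis
    unfolding self_shuffling_def by auto
qed

section \<open>Rotation words\<close>

text \<open>
  The index \<open>k\<close> of the interval \<open>[k, k + 1)\<close>, respectively \<open>(k, k + 1]\<close>, that contains \<open>t\<close>. The flag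
  selects one of the two conventions for the end points, so that both partitions of the circle
  are treated together; \<open>True\<close> stands for \<open>[0, 1 - \<alpha>)\<close>, \<open>[1 - \<alpha>, 1)\<close>.
\<close>

definition cell :: "bool \<Rightarrow> real \<Rightarrow> int" where
  "cell s t = (if s then \<lfloor>t\<rfloor> else \<lceil>t\<rceil> - 1)"

text \<open>
  The letter is 1 exactly if the rotation step from \<open>\<rho> + n\<alpha>\<close> passes an integer. In this form
  the number of ones in a prefix telescopes, and the intercept may be any real number.
\<close>

definition coding :: "bool \<Rightarrow> real \<Rightarrow> real \<Rightarrow> nat word" where
  "coding s \<alpha> \<rho> n = nat (cell s (\<rho> + real (Suc n) * \<alpha>) - cell s (\<rho> + real n * \<alpha>))"

lemma le_cell_iff: "k \<le> cell s t \<longleftrightarrow> (if s then of_int k \<le> t else of_int k < t)"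
  unfolding cell_def by (auto simp: le_floor_iff less_ceiling_iff)

lemma cell_eq_iff:
  "cell s t = k \<longleftrightarrow> (if s then of_int k \<le> t \<and> t < of_int k + 1 else of_int k < t \<and> t \<le> of_int k + 1)"
  unfolding cell_def by (auto simp: floor_eq_iff ceiling_eq_iff) linarith+

lemma cell_add_int: "cell s (t + of_int k) = cell s t + k"
  unfolding cell_def by simp

lemma cell_step:
  assumes "0 < \<alpha>" "\<alpha> < 1"
  shows "cell s t \<le> cell s (t + \<alpha>)" "cell s (t + \<alpha>) \<le> cell s t + 1"
  using assms unfolding cell_def by (auto split: if_splits) linarith+

lemma cell_bounds: "of_int (cell s t) \<le> t" "t - 1 \<le> of_int (cell s t)"
  unfolding cell_def by auto

lemma cell_uminus: "cell (\<not> s) (- t) = - cell s t - 1"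
  unfolding cell_def by (auto simp: ceiling_def)

lemma int_coding:
  assumes "0 < \<alpha>" "\<alpha> < 1"
  shows "int (coding s \<alpha> \<rho> n) = cell s (\<rho> + real (Suc n) * \<alpha>) - cell s (\<rho> + real n * \<alpha>)"
proof -
  have "\<rho> + real (Suc n) * \<alpha> = (\<rho> + real n * \<alpha>) + \<alpha>" by (simp add: algebra_simps)
  then show ?thesis using cell_step(1)[OF assms, of s "\<rho> + real n * \<alpha>"]
    by (simp only: coding_def)
qed

lemma coding_cases:
  assumes "0 < \<alpha>" "\<alpha> < 1"
  shows "coding s \<alpha> \<rho> n = 0 \<or> coding s \<alpha> \<rho> n = 1"
proof -
  have "\<rho> + real (Suc n) * \<alpha> = (\<rho> + real n * \<alpha>) + \<alpha>" by (simp add: algebra_simps)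
  then show ?thesis using cell_step[OF assms, of s "\<rho> + real n * \<alpha>"]
    by (simp only: coding_def) linarith
qed

lemma sum_coding:
  assumes "0 < \<alpha>" "\<alpha> < 1"
  shows "(\<Sum>i<n. int (coding s \<alpha> \<rho> i)) = cell s (\<rho> + real n * \<alpha>) - cell s \<rho>"
  by (induction n) (simp_all add: int_coding[OF assms])

lemma coding_shift_int: "coding s \<alpha> (\<rho> + of_int k) = coding s \<alpha> \<rho>"
proof
  fix n
  have "\<rho> + of_int k + real m * \<alpha> = (\<rho> + real m * \<alpha>) + of_int k" for m by simp
  then show "coding s \<alpha> (\<rho> + of_int k) n = coding s \<alpha> \<rho> n"
    unfolding coding_def by (simp only: cell_add_int)
qed

lemma suffix_coding: "suffix 1 (coding s \<alpha> \<rho>) = coding s \<alpha> (\<rho> + \<alpha>)"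
proof
  fix n
  have shift: "\<rho> + \<alpha> + real m * \<alpha> = \<rho> + real (Suc m) * \<alpha>" for m by (simp add: algebra_simps)
  show "suffix 1 (coding s \<alpha> \<rho>) n = coding s \<alpha> (\<rho> + \<alpha>) n"
    by (simp only: coding_def suffix_def shift) simp
qed

text \<open>
  Reflecting the circle turns the rotation by \<open>\<alpha>\<close> into that by \<open>-\<alpha>\<close>, which is \<open>1 - \<alpha>\<close> modulo 1, and
  exchanges the labels of the two arcs as well as the two conventions for their end points.
\<close>

lemma coding_complement:
  assumes "0 < \<alpha>" "\<alpha> < 1"
  shows "coding (\<not> s) (1 - \<alpha>) (- \<rho>) n = 1 - coding s \<alpha> \<rho> n"
proof -
  have "cell (\<not> s) (- \<rho> + real m * (1 - \<alpha>)) = int m - cell s (\<rho> + real m * \<alpha>) - 1" for m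
  proof -
    have "- \<rho> + real m * (1 - \<alpha>) = - (\<rho> + real m * \<alpha>) + of_int (int m)" by (simp add: algebra_simps)
    then have "cell (\<not> s) (- \<rho> + real m * (1 - \<alpha>)) = - cell s (\<rho> + real m * \<alpha>) - 1 + int m"
      by (simp only: cell_add_int cell_uminus)
    then show ?thesis by linarith
  qed
  from this[of n] this[of "Suc n"]
  have "int (coding (\<not> s) (1 - \<alpha>) (- \<rho>) n) = 1 - int (coding s \<alpha> \<rho> n)"
    using int_coding[of "1 - \<alpha>" "\<not> s" "- \<rho>" n] int_coding[OF assms, of s \<rho> n] assms by linarith
  then show ?thesis by linarith
qed

lemma self_shuffling_complement:
  assumes "0 < \<alpha>" "\<alpha> < 1"
  shows "self_shuffling (coding (\<not> s) (1 - \<alpha>) (- \<rho>)) \<longleftrightarrow> self_shuffling (coding s \<alpha> \<rho>)"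
proof -
  have imp: "self_shuffling (coding s \<alpha> \<rho>)"
    if "0 < \<alpha>" "\<alpha> < 1" "self_shuffling (coding (\<not> s) (1 - \<alpha>) (- \<rho>))" for s \<alpha> \<rho>
  proof (rule self_shuffling_substitution[OF that(3), of "\<lambda>a. [1 - a]"])
    have "coding s \<alpha> \<rho> n = 1 - coding (\<not> s) (1 - \<alpha>) (- \<rho>) n" for n
      using coding_cases[OF that(1,2), of s \<rho> n] coding_complement[OF that(1,2), of s \<rho> n] by auto
    then show "has_inf_product (\<lambda>n. [1 - coding (\<not> s) (1 - \<alpha>) (- \<rho>) n]) (coding s \<alpha> \<rho>)"
      by (intro has_inf_product_cuts[where c = "\<lambda>n. n"]) (simp_all add: strict_mono_def)
  qed simp
  show ?thesis using imp[of \<alpha> s \<rho>] imp[of "1 - \<alpha>" "\<not> s" "- \<rho>"] assms by auto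
qed

lemma sturmian_word_iff:
  "sturmian_word \<alpha> \<rho> x \<longleftrightarrow>
     0 < \<alpha> \<and> \<alpha> < 1 \<and> \<alpha> \<notin> \<rat> \<and> 0 \<le> \<rho> \<and> \<rho> < 1 \<and> (\<exists>s. x = coding s \<alpha> \<rho>)"
proof (cases "0 < \<alpha> \<and> \<alpha> < 1")
  case True
  have step: "real (Suc n) * \<alpha> = real n * \<alpha> + \<alpha>" for n by (simp add: algebra_simps)
  have lower: "coding True \<alpha> \<rho> n = (if frac (\<rho> + real n * \<alpha>) \<in> {0..<1 - \<alpha>} then 0 else 1)" for n
  proof -
    define t where "t = \<rho> + real n * \<alpha>"
    have "cell True (t + \<alpha>) = (if frac t \<in> {0..<1 - \<alpha>} then \<lfloor>t\<rfloor> else \<lfloor>t\<rfloor> + 1)"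
      unfolding cell_eq_iff frac_def using True by auto linarith+
    then show ?thesis unfolding coding_def step t_def by (auto simp: cell_def add.assoc)
  qed
  have upper: "coding False \<alpha> \<rho> n = (if frac (\<rho> + real n * \<alpha>) \<in> {0<..1 - \<alpha>} then 0 else 1)" for n
  proof -
    define t where "t = \<rho> + real n * \<alpha>"
    define k where "k = (if frac t = 0 then \<lfloor>t\<rfloor> - 1 else \<lfloor>t\<rfloor>)"
    have "cell False t = k"
      unfolding cell_eq_iff k_def frac_def by auto linarith+
    moreover have "cell False (t + \<alpha>) = (if frac t \<in> {0<..1 - \<alpha>} then k else k + 1)"
      unfolding cell_eq_iff k_def frac_def using True by auto linarith+
    ultimately show ?thesis unfolding coding_def step t_def by (auto simp: add.assoc)
  qed
  have "(\<exists>s. x = coding s \<alpha> \<rho>) \<longleftrightarrow> x = coding True \<alpha> \<rho> \<or> x = coding False \<alpha> \<rho>"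
    by (metis (full_types))
  then show ?thesis unfolding sturmian_word_def fun_eq_iff lower upper using True by auto
qed (auto simp: sturmian_word_def)

section \<open>Intercepts in the middle of the circle\<close>

text \<open>
  Here \<open>F n\<close> is the number of ones in the prefix of length \<open>n\<close>, and \<open>N p\<close> is the length of the
  shortest prefix with \<open>p\<close> ones. The two copies supply the ones of the word in turn, the first copy
  beginning. When the second copy has just supplied its \<open>n\<close>-th one, the word has been read up to
  \<open>N (2 * n)\<close> and the second copy up to \<open>N n\<close>, so the first copy has to stand at
  \<open>a n = N (2 * n) - N n\<close>. Likewise the second copy stands at \<open>b n = N (2 * n + 1) - N (n + 1)\<close> when the
  first one has just supplied its \<open>(n + 1)\<close>-st one. This is a shuffle if \<open>a n\<close> and \<open>b n\<close> lie between
  the \<open>n\<close>-th one and the next one, that is, in \<open>{N n..<N (n + 1)}\<close>. The lower bounds say that \<open>N\<close> is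
  superadditive at the arguments involved, which follows from \<open>\<alpha> \<le> \<rho>\<close>; the upper bounds follow from
  \<open>\<rho> \<le> 1 - \<alpha>\<close> in the same way.
\<close>

lemma self_shuffling_coding_middle:
  assumes "0 < \<alpha>" "\<alpha> \<le> \<rho>" "\<rho> \<le> 1 - \<alpha>"
  shows "self_shuffling (coding s \<alpha> \<rho>)"
proof -
  have \<alpha>: "0 < \<alpha>" "\<alpha> < 1" and \<rho>: "0 < \<rho>" "\<rho> < 1" using assms by linarith+
  define F where "F = (\<lambda>n. cell s (\<rho> + real n * \<alpha>))"
  define N where "N = (\<lambda>p. LEAST n. int p \<le> F n)"
  have F_Suc: "F n \<le> F (Suc n)" "F (Suc n) \<le> F n + 1" for n
    using cell_step[OF \<alpha>, of s "\<rho> + real n * \<alpha>"] by (simp_all add: F_def algebra_simps)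
  have F_mono: "F m \<le> F n" if "m \<le> n" for m n
    using that F_Suc(1) by (rule lift_Suc_mono_le[rotated])
  have F0: "F 0 = 0"
    unfolding F_def cell_eq_iff using \<rho> by simp
  have F_unbounded: "\<exists>n. int p \<le> F n" for p
  proof -
    obtain n where "real p + 1 < real n * \<alpha>"
      using ex_less_of_nat_mult[OF \<alpha>(1)] by blast
    then show ?thesis
      unfolding F_def le_cell_iff using \<rho> by (intro exI[of _ n]) simp
  qed
  have N_le_iff: "N p \<le> n \<longleftrightarrow> int p \<le> F n" for p n
    unfolding N_def
    using LeastI_ex[OF F_unbounded[of p]] Least_le[of "\<lambda>n. int p \<le> F n"] F_mono by (meson order_trans)
  have F_eq: "F n = int p" if "N p \<le> n" "n < N (Suc p)" for n p
    using that N_le_iff[of p n] N_le_iff[of "Suc p" n] by linarith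
  have N0: "N 0 = 0" using N_le_iff[of 0 0] F0 by simp
  have N_Suc: "N p < N (Suc p)" for p
  proof (cases "N p")
    case 0
    then have "p = 0" using N_le_iff[of p 0] F0 by simp
    then show ?thesis using 0 N_le_iff[of "Suc p" 0] F0 by simp
  next
    case (Suc n)
    then have "F n < int p" using N_le_iff[of p n] by linarith
    then have "F (N p) < int (Suc p)" using F_Suc(2)[of n] Suc by simp
    then show ?thesis using N_le_iff[of "Suc p" "N p"] by linarith
  qed
  \<comment> \<open>The case \<open>q = 0\<close> is separate: \<open>N 0 = 0\<close> is not preceded by a prefix with fewer ones. For
    \<open>p, q > 0\<close>, adding the inequalities for the prefixes that end just before the \<open>p\<close>-th and the
    \<open>q\<close>-th one leaves an excess of \<open>\<rho> - \<alpha>\<close>.\<close>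
  have super: "N p + N q \<le> N (p + q)" if "p = q \<or> p = Suc q" for p q
  proof (cases "q = 0")
    case True
    then show ?thesis using N0 by simp
  next
    case False
    with that obtain m n where mn: "N p = Suc m" "N q = Suc n"
      using N_Suc[of "p - 1"] N_Suc[of "q - 1"] by (metis Suc_pred' gr_zeroI less_imp_Suc_add nat.distinct(1))
    have "\<not> int p \<le> F m" "\<not> int q \<le> F n" using N_le_iff[of p m] N_le_iff[of q n] mn by linarith+
    then have "\<not> int (p + q) \<le> F (Suc (m + n))"
      unfolding F_def le_cell_iff using assms by (auto simp: algebra_simps split: if_splits)
    then show ?thesis using N_le_iff[of "p + q" "Suc (m + n)"] mn by linarith
  qed
  have sub: "N (p + q) + 1 \<le> N p + N (Suc q)" for p q
  proof -
    obtain n where n: "N (Suc q) = Suc n" using N_Suc[of q] less_imp_Suc_add by blast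
    have "int p \<le> F (N p)" "int (Suc q) \<le> F (Suc n)" using N_le_iff[of p "N p"] N_le_iff[of "Suc q" "Suc n"] n by simp_all
    then have "int (p + q) \<le> F (N p + n)"
      unfolding F_def le_cell_iff using assms by (auto simp: algebra_simps split: if_splits)
    then show ?thesis using N_le_iff[of "p + q" "N p + n"] n by linarith
  qed
  define a where "a = (\<lambda>n. N (2 * n) - N n)"
  define b where "b = (\<lambda>n. N (Suc (2 * n)) - N (Suc n))"
  have a: "a n + N n = N (2 * n)" "N n \<le> a n" "a n < N (Suc n)" for n
    using super[of n n] sub[of n n] by (auto simp: a_def mult_2)
  have b: "b n + N (Suc n) = N (Suc (2 * n))" "N n \<le> b n" "b n < N (Suc n)" for n
    using super[of "Suc n" n] sub[of "Suc n" n] by (auto simp: b_def mult_2)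
  \<comment> \<open>Equality of letters is checked through \<open>F\<close>: along each block the count of the word exceeds
    the count of the moving copy by a constant.\<close>
  have letter: "coding s \<alpha> \<rho> (i + d) = coding s \<alpha> \<rho> i"
    if "F (i + d) = F i + c" "F (Suc i + d) = F (Suc i) + c" for i d c
  proof -
    have "coding s \<alpha> \<rho> n = nat (F (Suc n) - F n)" for n by (simp only: coding_def F_def)
    then show ?thesis using that by simp
  qed
  have N2: "N (2 * Suc n) = N (Suc (Suc (2 * n)))" for n by simp
  show ?thesis
  proof (rule self_shufflingI[of a b])
    show "a 0 = 0" "b 0 = 0" by (simp_all add: a_def b_def)
    show "strict_mono a" "strict_mono b"
      using a b by (meson less_le_trans strict_mono_Suc_iff)+
  next
    fix n i assume i: "a n \<le> i" "i < a (Suc n)"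
    have "F (j + b n) = F j + int n" if "a n \<le> j" "j \<le> a (Suc n)" for j
    proof (cases "j < N (Suc n)")
      case True
      have "F j = int n" using True that a[of n] by (intro F_eq) linarith+
      moreover have "F (j + b n) = int (2 * n)"
        using True that a[of n] b[of n] by (intro F_eq) linarith+
      ultimately show ?thesis by simp
    next
      case False
      have "F j = int (Suc n)" using False that a[of "Suc n"] by (intro F_eq) linarith+
      moreover have "F (j + b n) = int (Suc (2 * n))"
        using False that a[of "Suc n"] b[of n] N2[of n] by (intro F_eq) linarith+
      ultimately show ?thesis by simp
    qed
    from this[of i] this[of "Suc i"] show "coding s \<alpha> \<rho> (i + b n) = coding s \<alpha> \<rho> i"
      using i by (intro letter[of _ _ "int n"]) auto
  next
    fix n i assume i: "b n \<le> i" "i < b (Suc n)"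
    have "F (j + a (Suc n)) = F j + int (Suc n)" if "b n \<le> j" "j \<le> b (Suc n)" for j
    proof (cases "j < N (Suc n)")
      case True
      have "F j = int n" using True that b[of n] by (intro F_eq) linarith+
      moreover have "F (j + a (Suc n)) = int (Suc (2 * n))"
        using True that a[of "Suc n"] b[of n] N2[of n] by (intro F_eq) linarith+
      ultimately show ?thesis by simp
    next
      case False
      have "F j = int (Suc n)" using False that b[of "Suc n"] by (intro F_eq) linarith+
      moreover have "F (j + a (Suc n)) = int (2 * Suc n)"
        using False that a[of "Suc n"] b[of "Suc n"] by (intro F_eq) linarith+
      ultimately show ?thesis by simp
    qed
    from this[of i] this[of "Suc i"] show "coding s \<alpha> \<rho> (i + a (Suc n)) = coding s \<alpha> \<rho> i"
      using i by (intro letter[of _ _ "int (Suc n)"]) auto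
  qed
qed

section \<open>Renormalization\<close>

text \<open>
  Restrict the rotation to the arc \<open>[0, 1 - \<alpha>)\<close> of the letter 0. A point of this arc returns to it
  after one step, or after two steps if the first one leads to the arc of the letter 1; in the
  latter case it reads \<open>01\<close>. The return map, rescaled by \<open>1 / (1 - \<alpha>)\<close>, is the rotation by
  \<open>\<alpha> / (1 - \<alpha>)\<close>. Thus the word arises by the substitution \<open>0 \<mapsto> 0\<close>, \<open>1 \<mapsto> 01\<close>. The
  time of the \<open>n\<close>-th return is \<open>n\<close> plus the number of ones in the prefix of length \<open>n\<close> of the
  coarser word.
\<close>

lemma self_shuffling_coding_zoom_small_slope:
  assumes "0 < \<alpha>" "\<alpha> < 1/2" "0 < \<rho>" "\<rho> < 1 - \<alpha>"
    and "self_shuffling (coding s (\<alpha> / (1 - \<alpha>)) (\<rho> / (1 - \<alpha>)))"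
  shows "self_shuffling (coding s \<alpha> \<rho>)"
proof -
  define \<alpha>' \<rho>' where "\<alpha>' = \<alpha> / (1 - \<alpha>)" and "\<rho>' = \<rho> / (1 - \<alpha>)"
  have \<alpha>': "0 < \<alpha>'" "\<alpha>' < 1" using assms by (simp_all add: \<alpha>'_def)
  define F where "F = (\<lambda>n. cell s (\<rho>' + real n * \<alpha>'))"
  define G where "G = (\<lambda>n. cell s (\<rho> + real n * \<alpha>))"
  define x y where "x = coding s \<alpha> \<rho>" and "y = coding s \<alpha>' \<rho>'"
  have y: "y n = nat (F (Suc n) - F n)" for n by (simp only: y_def coding_def F_def)
  have x: "x n = nat (G (Suc n) - G n)" for n by (simp only: x_def coding_def G_def)
  have le_F: "k \<le> F n \<longleftrightarrow> (if s then of_int k * (1 - \<alpha>) \<le> \<rho> + real n * \<alpha>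
                                  else of_int k * (1 - \<alpha>) < \<rho> + real n * \<alpha>)" for k n
  proof -
    have "\<rho>' + real n * \<alpha>' = (\<rho> + real n * \<alpha>) / (1 - \<alpha>)"
      unfolding \<rho>'_def \<alpha>'_def by (simp add: add_divide_distrib)
    then show ?thesis
      using assms(2) unfolding F_def le_cell_iff by (simp add: pos_le_divide_eq pos_less_divide_eq)
  qed
  have F_Suc: "F n \<le> F (Suc n)" "F (Suc n) \<le> F n + 1" for n
    using cell_step[OF \<alpha>', of s "\<rho>' + real n * \<alpha>'"] by (simp_all add: F_def algebra_simps)
  have F0: "F 0 = 0"
    unfolding F_def cell_eq_iff \<rho>'_def using assms by simp
  have F_nonneg: "0 \<le> F n" for n
    by (induction n) (use F0 F_Suc(1) order_trans in auto)
  define c where "c = (\<lambda>n. n + nat (F n))"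
  have rc: "real (c n) = real n + of_int (F n)" for n
    using F_nonneg[of n] by (simp add: c_def)
  have G0: "G (c n) = F n" and G1: "G (Suc (c n)) = F n" for n
    using le_F[of "F n" n] le_F[of "F n + 1" n] assms(1,2)
    unfolding G_def cell_eq_iff by (auto simp: rc algebra_simps split: if_splits)
  have G2: "G (Suc (Suc (c n))) = F n + 1" if "F (Suc n) = F n + 1" for n
    using le_F[of "F n" n] le_F[of "F n + 1" n] le_F[of "F n + 1" "Suc n"] that assms(1,2)
    unfolding G_def cell_eq_iff by (auto simp: rc algebra_simps split: if_splits)
  define \<tau> :: "nat \<Rightarrow> nat list" where "\<tau> = (\<lambda>a. if a = 0 then [0] else [0, 1])"
  have "has_inf_product (\<lambda>n. \<tau> (y n)) x"
  proof (rule has_inf_product_cuts[of c])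
    show "c 0 = 0" using F0 by (simp add: c_def)
    show "strict_mono c" unfolding strict_mono_Suc_iff c_def using F_Suc(1) F_nonneg
      by (metis add_less_le_mono lessI nat_mono)
    fix n
    consider "F (Suc n) = F n" | "F (Suc n) = F n + 1" using F_Suc[of n] by linarith
    then show "\<tau> (y n) = map x [c n..<c (Suc n)]"
    proof cases
      case 1
      then have "c (Suc n) = Suc (c n)" by (simp add: c_def)
      then show ?thesis using 1 G0[of n] G1[of n] by (simp add: \<tau>_def x y)
    next
      case 2
      then have "c (Suc n) = Suc (Suc (c n))" using F_nonneg[of n] by (simp add: c_def nat_add_distrib)
      then show ?thesis using 2 G0[of n] G1[of n] G2[of n] by (simp add: \<tau>_def x y)
    qed
  qed
  moreover have "\<tau> a \<noteq> []" for a by (simp add: \<tau>_def)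
  ultimately show ?thesis
    using self_shuffling_substitution[of y \<tau> x] assms(5) unfolding x_def y_def \<alpha>'_def \<rho>'_def by blast
qed

text \<open>
  For \<open>\<alpha> > 1 / 2\<close> restrict to \<open>[0, \<alpha>)\<close>, which consists of the points that do not follow a zero.
  The return word is \<open>01\<close> if the point is labelled 0, and \<open>1\<close> otherwise, so that the substitution is
  \<open>0 \<mapsto> 01\<close>, \<open>1 \<mapsto> 1\<close>, and the return map rescales to the rotation by \<open>(2\<alpha> - 1) / \<alpha>\<close>.
  The time of the \<open>n\<close>-th return is \<open>n\<close> plus the number of zeros in the prefix of length \<open>n\<close> of the
  coarser word.
\<close>

lemma self_shuffling_coding_zoom_large_slope:
  assumes "1/2 < \<alpha>" "\<alpha> < 1" "0 < \<rho>" "\<rho> < \<alpha>"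
    and "self_shuffling (coding s (2 - 1 / \<alpha>) (\<rho> / \<alpha>))"
  shows "self_shuffling (coding s \<alpha> \<rho>)"
proof -
  define \<alpha>' \<rho>' where "\<alpha>' = 2 - 1 / \<alpha>" and "\<rho>' = \<rho> / \<alpha>"
  have \<alpha>': "0 < \<alpha>'" "\<alpha>' < 1" using assms by (simp_all add: \<alpha>'_def field_simps)
  define F where "F = (\<lambda>n. cell s (\<rho>' + real n * \<alpha>'))"
  define G where "G = (\<lambda>n. cell s (\<rho> + real n * \<alpha>))"
  define x y where "x = coding s \<alpha> \<rho>" and "y = coding s \<alpha>' \<rho>'"
  have y: "y n = nat (F (Suc n) - F n)" for n by (simp only: y_def coding_def F_def)
  have x: "x n = nat (G (Suc n) - G n)" for n by (simp only: x_def coding_def G_def)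
  have le_F: "k \<le> F n \<longleftrightarrow> (if s then of_int k * \<alpha> \<le> \<rho> + real n * (2 * \<alpha> - 1)
                                  else of_int k * \<alpha> < \<rho> + real n * (2 * \<alpha> - 1))" for k n
  proof -
    have "\<rho>' + real n * \<alpha>' = (\<rho> + real n * (2 * \<alpha> - 1)) / \<alpha>"
      unfolding \<rho>'_def \<alpha>'_def using assms(1) by (simp add: field_simps)
    then show ?thesis
      using assms(1) unfolding F_def le_cell_iff by (simp add: pos_le_divide_eq pos_less_divide_eq)
  qed
  have F_Suc: "F n \<le> F (Suc n)" "F (Suc n) \<le> F n + 1" for n
    using cell_step[OF \<alpha>', of s "\<rho>' + real n * \<alpha>'"] by (simp_all add: F_def algebra_simps)
  have F0: "F 0 = 0"
    unfolding F_def cell_eq_iff \<rho>'_def using assms by simp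
  have F_le: "F n \<le> int n" for n
  proof (induction n)
    case (Suc n)
    then show ?case using F_Suc(2)[of n] by simp
  qed (simp add: F0)
  define c where "c = (\<lambda>n. nat (2 * int n - F n))"
  have c: "int (c n) = 2 * int n - F n" for n
    using F_le[of n] by (simp add: c_def)
  have rc: "real (c n) = 2 * real n - of_int (F n)" for n
    using arg_cong[OF c, of real_of_int n] by simp
  have G0: "G (c n) = int n" for n
    using le_F[of "F n" n] le_F[of "F n + 1" n] assms(1,2)
    unfolding G_def cell_eq_iff by (auto simp: rc algebra_simps split: if_splits)
  have G1: "G (Suc (c n)) = int n" and G2: "G (Suc (Suc (c n))) = int n + 1" if "F (Suc n) = F n" for n
    using le_F[of "F n" n] le_F[of "F n + 1" n] le_F[of "F n + 1" "Suc n"] that assms(1,2)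
    unfolding G_def cell_eq_iff by (auto simp: rc algebra_simps split: if_splits)
  have G1': "G (Suc (c n)) = int n + 1" if "F (Suc n) = F n + 1" for n
    using le_F[of "F n" n] le_F[of "F n + 1" n] le_F[of "F n + 1" "Suc n"] that assms(1,2)
    unfolding G_def cell_eq_iff by (auto simp: rc algebra_simps split: if_splits)
  define \<tau> :: "nat \<Rightarrow> nat list" where "\<tau> = (\<lambda>a. if a = 0 then [0, 1] else [1])"
  have "has_inf_product (\<lambda>n. \<tau> (y n)) x"
  proof (rule has_inf_product_cuts[of c])
    show "c 0 = 0" using F0 by (simp add: c_def)
    have "c n < c (Suc n)" for n
    proof -
      have "int (c n) < int (c (Suc n))" unfolding c using F_Suc(2)[of n] by simp
      then show ?thesis by simp
    qed
    then show "strict_mono c" unfolding strict_mono_Suc_iff by blast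
    fix n
    consider "F (Suc n) = F n" | "F (Suc n) = F n + 1" using F_Suc[of n] by linarith
    then show "\<tau> (y n) = map x [c n..<c (Suc n)]"
    proof cases
      case 1
      then have "int (c (Suc n)) = int (Suc (Suc (c n)))" using c[of n] c[of "Suc n"] by simp
      then have "c (Suc n) = Suc (Suc (c n))" by (simp only: of_nat_eq_iff)
      then show ?thesis using 1 G0[of n] G1[of n] G2[of n] by (simp add: \<tau>_def x y)
    next
      case 2
      then have "int (c (Suc n)) = int (Suc (c n))" using c[of n] c[of "Suc n"] by simp
      then have "c (Suc n) = Suc (c n)" by (simp only: of_nat_eq_iff)
      then show ?thesis using 2 G0[of n] G1'[of n] by (simp add: \<tau>_def x y)
    qed
  qed
  moreover have "\<tau> a \<noteq> []" for a by (simp add: \<tau>_def)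
  ultimately show ?thesis
    using self_shuffling_substitution[of y \<tau> x] assms(5) unfolding x_def y_def \<alpha>'_def \<rho>'_def by blast
qed

lemma self_shuffling_coding_reflect:
  assumes "0 < \<alpha>" "\<alpha> < 1"
  shows "self_shuffling (coding (\<not> s) (1 - \<alpha>) (1 - \<rho>)) \<longleftrightarrow> self_shuffling (coding s \<alpha> \<rho>)"
  using self_shuffling_complement[OF assms, of s \<rho>] coding_shift_int[of "\<not> s" "1 - \<alpha>" "- \<rho>" 1]
  by (simp add: add.commute)

lemma self_shuffling_coding_central:
  assumes "0 < \<alpha>" "\<alpha> < 1" "min \<alpha> (1 - \<alpha>) \<le> \<rho>" "\<rho> \<le> max \<alpha> (1 - \<alpha>)"
  shows "self_shuffling (coding s \<alpha> \<rho>)"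
proof (cases "\<alpha> \<le> 1 - \<alpha>")
  case True
  then show ?thesis using assms by (intro self_shuffling_coding_middle) (auto simp: min_def max_def)
next
  case False
  then have "self_shuffling (coding (\<not> s) (1 - \<alpha>) (1 - \<rho>))"
    using assms by (intro self_shuffling_coding_middle) (auto simp: min_def max_def)
  then show ?thesis using self_shuffling_coding_reflect assms by blast
qed

text \<open>
  Unless \<open>\<rho>\<close> is already in the middle, \<open>e \<le> \<rho> < min \<alpha> (1 - \<alpha>)\<close>, and one zoom divides \<open>\<rho>\<close> by
  \<open>max \<alpha> (1 - \<alpha>) < 1 - e\<close>. As the bound \<open>e\<close> stays valid for the larger intercepts, at most \<open>n\<close> zooms
  are possible if \<open>1 \<le> \<rho> / (1 - e) ^ n\<close>. A zoom cannot carry \<open>\<rho>\<close> past the middle: it maps the bound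
  \<open>min \<alpha> (1 - \<alpha>)\<close> to one of the two arc lengths of the new rotation, so that \<open>\<rho> \<le> max \<alpha> (1 - \<alpha>)\<close> persists.
\<close>

lemma self_shuffling_coding_by_zooming:
  assumes "0 < \<alpha>" "\<alpha> < 1" "\<alpha> \<notin> \<rat>" "0 < e" "e \<le> \<rho>" "\<rho> \<le> max \<alpha> (1 - \<alpha>)" "1 \<le> \<rho> / (1 - e) ^ n"
    "e < 1"
  shows "self_shuffling (coding s \<alpha> \<rho>)"
  using assms
proof (induction n arbitrary: \<alpha> \<rho>)
  case 0
  then show ?case by simp
next
  case (Suc n)
  have power_split: "\<rho> / (1 - e) ^ Suc n = \<rho> / (1 - e) / (1 - e) ^ n" by simp
  have "\<alpha> \<noteq> 1 / 2" using Suc.prems(3) by (metis Rats_1 Rats_divide Rats_number_of)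
  then consider (central) "min \<alpha> (1 - \<alpha>) \<le> \<rho>" | (small) "\<rho> < \<alpha>" "\<alpha> < 1 / 2" | (large) "\<rho> < 1 - \<alpha>" "\<alpha> > 1 / 2"
    unfolding min_def by (smt (verit) field_sum_of_halves)
  then show ?case
  proof cases
    case central
    then show ?thesis using Suc.prems(1,2,6) self_shuffling_coding_central by blast
  next
    case small
    have "self_shuffling (coding s (\<alpha> / (1 - \<alpha>)) (\<rho> / (1 - \<alpha>)))"
    proof (rule Suc.IH)
      show "\<alpha> / (1 - \<alpha>) \<notin> \<rat>"
      proof
        assume "\<alpha> / (1 - \<alpha>) \<in> \<rat>"
        then have "(\<alpha> / (1 - \<alpha>)) / (1 + \<alpha> / (1 - \<alpha>)) \<in> \<rat>"
          by (intro Rats_divide[of "\<alpha> / (1 - \<alpha>)"] Rats_add[OF Rats_1])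
        moreover have "(\<alpha> / (1 - \<alpha>)) / (1 + \<alpha> / (1 - \<alpha>)) = \<alpha>" using small by (simp add: field_simps)
        ultimately show False using Suc.prems(3) by simp
      qed
      have "\<rho> / (1 - \<alpha>) \<le> \<alpha> / (1 - \<alpha>)" using small by (simp add: divide_right_mono)
      then show "\<rho> / (1 - \<alpha>) \<le> max (\<alpha> / (1 - \<alpha>)) (1 - \<alpha> / (1 - \<alpha>))" by simp
      have ge: "\<rho> / (1 - e) \<le> \<rho> / (1 - \<alpha>)"
        using small Suc.prems(1,2,4,5,6,8) by (intro divide_left_mono) auto
      have "\<rho> \<le> \<rho> / (1 - \<alpha>)" using small Suc.prems(1,2,4,5,6,8) by (simp add: pos_le_divide_eq)
      then show "e \<le> \<rho> / (1 - \<alpha>)" using Suc.prems(1,2,4,5,6,8) by linarith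
      have "\<rho> / (1 - e) / (1 - e) ^ n \<le> \<rho> / (1 - \<alpha>) / (1 - e) ^ n"
        using Suc.prems(1,2,4,5,6,8) by (intro divide_right_mono ge) simp
      then show "1 \<le> \<rho> / (1 - \<alpha>) / (1 - e) ^ n" using Suc.prems(7) power_split by linarith
    qed (use small Suc.prems(1,2,4,8) in simp_all)
    from self_shuffling_coding_zoom_small_slope[OF _ _ _ _ this] show ?thesis
      using small Suc.prems(1,2,4,5) by simp
  next
    case large
    have "self_shuffling (coding s (2 - 1 / \<alpha>) (\<rho> / \<alpha>))"
    proof (rule Suc.IH)
      show "2 - 1 / \<alpha> \<notin> \<rat>"
      proof
        assume "2 - 1 / \<alpha> \<in> \<rat>"
        then have "1 / (2 - (2 - 1 / \<alpha>)) \<in> \<rat>" by (rule Rats_divide[OF Rats_1 Rats_diff[OF Rats_number_of]])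
        then show False using Suc.prems(3) by simp
      qed
      have "\<rho> / \<alpha> \<le> (1 - \<alpha>) / \<alpha>" using large by (simp add: divide_right_mono)
      also have "(1 - \<alpha>) / \<alpha> = 1 - (2 - 1 / \<alpha>)" using large by (simp add: field_simps)
      finally show "\<rho> / \<alpha> \<le> max (2 - 1 / \<alpha>) (1 - (2 - 1 / \<alpha>))" by simp
      have ge: "\<rho> / (1 - e) \<le> \<rho> / \<alpha>"
        using large Suc.prems(1,2,4,5,6,8) by (intro divide_left_mono) auto
      have "\<rho> \<le> \<rho> / \<alpha>" using large Suc.prems(1,2,4,5,6,8) by (simp add: pos_le_divide_eq)
      then show "e \<le> \<rho> / \<alpha>" using Suc.prems(1,2,4,5,6,8) by linarith
      have "\<rho> / (1 - e) / (1 - e) ^ n \<le> \<rho> / \<alpha> / (1 - e) ^ n"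
        using Suc.prems(1,2,4,5,6,8) by (intro divide_right_mono ge) simp
      then show "1 \<le> \<rho> / \<alpha> / (1 - e) ^ n"
        using Suc.prems(7) power_split by linarith
      show "0 < 2 - 1 / \<alpha>" "2 - 1 / \<alpha> < 1" using large Suc.prems(1,2,4,5,6,8) by (simp_all add: field_simps)
    qed (use Suc.prems(4,8) in simp_all)
    from self_shuffling_coding_zoom_large_slope[OF _ _ _ _ this] show ?thesis
      using large Suc.prems(1,2,4,5) by simp
  qed
qed

lemma self_shuffling_coding:
  assumes "0 < \<alpha>" "\<alpha> < 1" "\<alpha> \<notin> \<rat>" "0 < \<rho>" "\<rho> < 1"
  shows "self_shuffling (coding s \<alpha> \<rho>)"
proof -
  have le: "self_shuffling (coding s \<alpha> \<rho>)"
    if *: "0 < \<alpha>" "\<alpha> < 1" "\<alpha> \<notin> \<rat>" "0 < \<rho>" "\<rho> < 1" "\<rho> \<le> max \<alpha> (1 - \<alpha>)" for s \<alpha> \<rho>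
  proof -
    obtain n where "(1 - \<rho>) ^ n < \<rho>" using real_arch_pow_inv[of \<rho> "1 - \<rho>"] * by auto
    then have "1 \<le> \<rho> / (1 - \<rho>) ^ n" using * by simp
    then show ?thesis using * self_shuffling_coding_by_zooming[of \<alpha> \<rho> \<rho> n] by simp
  qed
  show ?thesis
  proof (cases "\<rho> \<le> max \<alpha> (1 - \<alpha>)")
    case True
    then show ?thesis using le assms by blast
  next
    case False
    have "1 - \<alpha> \<notin> \<rat>"
      using assms(3) Rats_diff[OF Rats_1, of "1 - \<alpha>"] by auto
    then have "self_shuffling (coding (\<not> s) (1 - \<alpha>) (1 - \<rho>))"
      using False assms by (intro le) auto
    then show ?thesis using self_shuffling_coding_reflect assms by blast
  qed
qed

section \<open>Intercept zero\<close>

text \<open>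
  Counting ones along a shuffle: whenever a copy is at \<open>i\<close> and the other one at \<open>j\<close>, the count is
  additive. \<open>u n\<close> and \<open>v n\<close> are the positions of the two copies after \<open>n\<close> rounds; within a round the
  first copy moves before the second one does.
\<close>

lemma self_shuffling_path:
  fixes x :: "nat word"
  assumes "self_shuffling x"
  obtains u v where "mono u" "mono v" "\<forall>m. \<exists>n. m \<le> u n" "\<forall>m. \<exists>n. m \<le> v n"
    and "\<forall>n. \<forall>i\<in>{u n..u (Suc n)}. sum x {..<i + v n} = sum x {..<i} + sum x {..<v n}"
    and "\<forall>n. \<forall>j\<in>{v n..v (Suc n)}. sum x {..<u (Suc n) + j} = sum x {..<u (Suc n)} + sum x {..<j}"
proof -
  obtain U V where UV: "has_inf_product (\<lambda>i. U i @ V i) x"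
    and U: "has_inf_product U x" and V: "has_inf_product V x"
    using assms unfolding self_shuffling_def by blast
  define P where "P = (\<lambda>W n. concat (map W [0..<n]) :: nat list)"
  have P_Suc: "P W (Suc n) = P W n @ W n" for W n by (simp add: P_def)
  have prefix_sum: "sum_list w = sum x {..<length w}" if "w @ w' = P W n" "has_inf_product W x" for w w' W n
  proof -
    have "w @ w' = map x [0..<length (w @ w')]"
      using has_inf_product_prefix[OF that(2), of n] that(1) by (simp add: P_def)
    also have "\<dots> = map x [0..<length w] @ map x [length w..<length (w @ w')]"
      by (metis length_append map_append upt_add_eq_append zero_le)
    finally have "w = map x [0..<length w]" by simp
    then have "sum_list w = sum_list (map x [0..<length w])" by simp
    then show ?thesis by (simp add: interv_sum_list_conv_sum_set_nat atLeast0LessThan)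
  qed
  have len: "length (P (\<lambda>i. U i @ V i) n) = length (P U n) + length (P V n)"
    and sum: "sum_list (P (\<lambda>i. U i @ V i) n) = sum_list (P U n) + sum_list (P V n)" for n
    by (induction n) (simp_all add: P_def)
  define u v where "u = (\<lambda>n. length (P U n))" and "v = (\<lambda>n. length (P V n))"
  have mono: "mono u" "mono v" unfolding mono_iff_le_Suc u_def v_def by (simp_all add: P_Suc)
  have unb: "\<exists>n. m \<le> u n" "\<exists>n. m \<le> v n" for m
    using U V unfolding has_inf_product_def u_def v_def P_def by auto
  have Pn: "sum_list (P U k) = sum x {..<u k}" "sum_list (P V k) = sum x {..<v k}" for k
    using prefix_sum[of _ "[]", OF _ U] prefix_sum[of _ "[]", OF _ V] by (simp_all add: u_def v_def)
  have path_u: "sum x {..<i + v n} = sum x {..<i} + sum x {..<v n}" if "u n \<le> i" "i \<le> u (Suc n)" for n i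
  proof -
    define t where "t = take (i - u n) (U n)"
    have t: "length (P U n @ t) = i" using that by (simp add: t_def u_def P_Suc)
    have "sum_list (P U n @ t) = sum x {..<i}"
      using prefix_sum[of "P U n @ t" "drop (i - u n) (U n)" U "Suc n"] U t
      by (simp add: P_Suc t_def)
    moreover have "sum_list (P (\<lambda>i. U i @ V i) n @ t) = sum x {..<i + v n}"
    proof -
      have "(P (\<lambda>i. U i @ V i) n @ t) @ drop (i - u n) (U n) @ V n = P (\<lambda>i. U i @ V i) (Suc n)"
        unfolding P_Suc t_def by (metis append.assoc append_take_drop_id)
      moreover have "length (P (\<lambda>i. U i @ V i) n @ t) = i + v n"
        using t by (simp add: len v_def)
      ultimately show ?thesis using prefix_sum UV by metis
    qed
    ultimately show ?thesis using Pn[of n] by (simp add: sum)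
  qed
  have path_v: "sum x {..<u (Suc n) + j} = sum x {..<u (Suc n)} + sum x {..<j}" if "v n \<le> j" "j \<le> v (Suc n)" for n j
  proof -
    define t where "t = take (j - v n) (V n)"
    have t: "length (P V n @ t) = j" using that by (simp add: t_def v_def P_Suc)
    have "sum_list (P V n @ t) = sum x {..<j}"
      using prefix_sum[of "P V n @ t" "drop (j - v n) (V n)" V "Suc n"] V t
      by (simp add: P_Suc t_def)
    moreover have "sum_list (P (\<lambda>i. U i @ V i) n @ U n @ t) = sum x {..<u (Suc n) + j}"
    proof -
      have "(P (\<lambda>i. U i @ V i) n @ U n @ t) @ drop (j - v n) (V n) = P (\<lambda>i. U i @ V i) (Suc n)"
        unfolding P_Suc t_def by simp
      moreover have "length (P (\<lambda>i. U i @ V i) n @ U n @ t) = u (Suc n) + j"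
        using t by (simp add: len u_def P_Suc)
      ultimately show ?thesis using prefix_sum UV by metis
    qed
    ultimately show ?thesis using Pn[of n] Pn(1)[of "Suc n"] by (simp add: sum P_Suc)
  qed
  show ?thesis by (rule that[OF mono]) (simp_all add: unb path_u path_v)
qed

text \<open>
  Successive best approximations of an integer by multiples of \<open>\<alpha>\<close> lie on alternate sides: if \<open>s < t\<close>
  are successive ones and both lie above, then \<open>(t - s)\<alpha>\<close> is closer to an integer than \<open>s\<alpha>\<close>,
  although \<open>t - s < t\<close>. Hence one of two successive best approximations lies below an integer, and
  it serves as \<open>q\<close>.
\<close>

lemma frac_multiple_records:
  fixes \<alpha> :: real
  assumes "\<alpha> \<notin> \<rat>"
  obtains q where "q > Q" "\<And>n. 0 < n \<Longrightarrow> n \<le> q \<Longrightarrow> 1 \<le> frac (real n * \<alpha>) + frac (real q * \<alpha>)"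
proof -
  define f where "f = (\<lambda>n. frac (real n * \<alpha>))"
  define d where "d = (\<lambda>n. min (f n) (1 - f n))"
  have f_pos: "0 < f n" "f n < 1" if "0 < n" for n
  proof -
    have "real n * \<alpha> \<notin> \<int>"
    proof
      assume "real n * \<alpha> \<in> \<int>"
      then have "real n * \<alpha> / real n \<in> \<rat>" using Ints_subset_Rats by (intro Rats_divide) auto
      then show False using assms that by simp
    qed
    then show "0 < f n" "f n < 1" by (simp_all add: f_def frac_gt_0_iff frac_lt_1)
  qed
  have first: "\<exists>s>0. d s < e \<and> (\<forall>n>0. n < s \<longrightarrow> e \<le> d n)" if "e > 0" for e
  proof -
    obtain k where "k > 0" "\<bar>frac (real k * \<alpha>) - 0\<bar> < e"
      using Kronecker_approx_1_explicit[OF assms order_refl zero_le_one \<open>e > 0\<close>] .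
    then have "k > 0 \<and> d k < e" unfolding d_def f_def by linarith
    then have "\<exists>k. k > 0 \<and> d k < e" ..
    then have "(LEAST k. k > 0 \<and> d k < e) > 0 \<and> d (LEAST k. k > 0 \<and> d k < e) < e"
      by (rule LeastI_ex)
    moreover have "e \<le> d n" if "n > 0" "n < (LEAST k. k > 0 \<and> d k < e)" for n
      using not_less_Least[OF that(2)] that(1) by auto
    ultimately show ?thesis by blast
  qed
  note found = that
  have good: thesis if "s > Q" "f s > 1/2" "\<And>n. 0 < n \<Longrightarrow> n < s \<Longrightarrow> d s \<le> d n" for s
  proof (rule found)
    fix n assume "0 < n" "n \<le> s"
    have ds: "d s = 1 - f s" and dn: "d n \<le> f n" using that(2) by (simp_all add: d_def)
    have "1 - f s \<le> f n"
    proof (cases "n = s")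
      case True
      then show ?thesis using that(2) by simp
    next
      case False
      then show ?thesis using that(3)[of n] \<open>0 < n\<close> \<open>n \<le> s\<close> ds dn by simp
    qed
    then show "1 \<le> frac (real n * \<alpha>) + frac (real s * \<alpha>)" by (simp add: f_def)
  qed fact
  \<comment> \<open>Falling below all distances at times up to \<open>Q\<close> forces the record to come after \<open>Q\<close>. The
    number 1 only makes the set nonempty.\<close>
  define e where "e = Min (insert 1 (d ` {1..Q}))"
  have "e > 0" unfolding e_def using f_pos by (auto simp: d_def Suc_le_eq)
  have e_le: "e \<le> d n" if "0 < n" "n \<le> Q" for n unfolding e_def using that by (intro Min_le) auto
  obtain s where s: "s > 0" "d s < e" "\<And>n. 0 < n \<Longrightarrow> n < s \<Longrightarrow> e \<le> d n"
    using first[OF \<open>e > 0\<close>] by blast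
  have "s > Q" using s(1,2) e_le[of s] by linarith
  show thesis
  proof (cases "f s > 1/2")
    case True
    have "d s \<le> d n" if "0 < n" "n < s" for n using s(2) s(3)[OF that] by simp
    then show ?thesis using good \<open>s > Q\<close> True by blast
  next
    case False
    then have ds: "d s = f s" by (simp add: d_def)
    have "d s > 0" using f_pos[OF s(1)] by (simp add: d_def)
    obtain t where t: "t > 0" "d t < d s" "\<And>n. 0 < n \<Longrightarrow> n < t \<Longrightarrow> d s \<le> d n"
      using first[OF \<open>d s > 0\<close>] by blast
    have "s < t" using t(1,2) s(2) s(3)[of t] by (cases t s rule: linorder_cases) auto
    have ft: "f t > 1/2"
    proof (rule ccontr)
      assume "\<not> f t > 1/2"
      then have dt: "d t = f t" by (simp add: d_def)
      have "f (t - s) = f t - f s + 1"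
      proof -
        have "real (t - s) * \<alpha> = real t * \<alpha> - real s * \<alpha>" using \<open>s < t\<close> by (simp add: of_nat_diff algebra_simps)
        then show ?thesis
          unfolding f_def using t(2) ds dt f_pos[OF s(1)] f_pos[OF t(1)]
          by (subst frac_unique_iff) (auto simp: f_def frac_def)
      qed
      then have "d (t - s) < d s" using ds dt f_pos[OF t(1)] by (simp add: d_def)
      then show False using t(3)[of "t - s"] \<open>s < t\<close> s(1) by auto
    qed
    have "d t \<le> d n" if "0 < n" "n < t" for n using t(2) t(3)[OF that] by simp
    then show ?thesis using good ft \<open>s > Q\<close> \<open>s < t\<close> less_trans by blast
  qed
qed

text \<open>
  Once both copies have left position 0, choose a record time \<open>q\<close> that neither has reached. In the
  round \<open>n\<close> in which a copy reaches \<open>q\<close> for the first time, the other copy stands at a positive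
  position below \<open>q\<close>, which contradicts additivity of the count.
\<close>

lemma not_self_shuffling_coding_0:
  assumes "0 < \<alpha>" "\<alpha> < 1" "\<alpha> \<notin> \<rat>"
  shows "\<not> self_shuffling (coding s \<alpha> 0)"
proof -
  have lower: "\<not> self_shuffling (coding True \<alpha> 0)"
    if \<alpha>: "0 < \<alpha>" "\<alpha> < 1" "\<alpha> \<notin> \<rat>" for \<alpha>
  proof
    define x where "x = coding True \<alpha> 0"
    assume "self_shuffling (coding True \<alpha> 0)"
    then have sx: "self_shuffling x" by (simp only: x_def)
    obtain u v where mono: "mono u" "mono v"
      and unb: "\<forall>m. \<exists>n. m \<le> u n" "\<forall>m. \<exists>n. m \<le> v n"
      and u: "\<forall>n. \<forall>i\<in>{u n..u (Suc n)}. sum x {..<i + v n} = sum x {..<i} + sum x {..<v n}"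
      and v: "\<forall>n. \<forall>j\<in>{v n..v (Suc n)}.
                sum x {..<u (Suc n) + j} = sum x {..<u (Suc n)} + sum x {..<j}"
      by (rule self_shuffling_path[OF sx])
    have frac_add: "frac (real i * \<alpha>) + frac (real j * \<alpha>) < 1"
      if "sum x {..<i + j} = sum x {..<i} + sum x {..<j}" for i j
    proof -
      have "int (sum x {..<n}) = \<lfloor>real n * \<alpha>\<rfloor>" for n
        using sum_coding[OF \<alpha>(1,2), of True 0 n] by (simp add: x_def cell_def)
      then have "\<lfloor>real (i + j) * \<alpha>\<rfloor> = \<lfloor>real i * \<alpha>\<rfloor> + \<lfloor>real j * \<alpha>\<rfloor>"
        using that by (metis of_nat_add)
      then show ?thesis unfolding frac_def by (simp add: algebra_simps) linarith
    qed
    obtain n1 n2 where "1 \<le> u n1" "1 \<le> v n2" using unb by blast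
    define n0 where "n0 = max n1 n2"
    have n0: "1 \<le> u n" "1 \<le> v n" if "n0 \<le> n" for n
      using monoD[OF mono(1), of n1 n] monoD[OF mono(2), of n2 n] that \<open>1 \<le> u n1\<close> \<open>1 \<le> v n2\<close>
      unfolding n0_def by linarith+
    obtain q where q: "q > u n0 + v n0"
      "\<And>n. 0 < n \<Longrightarrow> n \<le> q \<Longrightarrow> 1 \<le> frac (real n * \<alpha>) + frac (real q * \<alpha>)"
      using frac_multiple_records[OF \<alpha>(3)] by blast
    define n where "n = (LEAST n. q \<le> u (Suc n) \<or> q \<le> v (Suc n))"
    obtain k where "q \<le> u k" using unb(1) by blast
    also have "u k \<le> u (Suc k)" using mono(1) by (simp add: monoD)
    finally have "\<exists>n. q \<le> u (Suc n) \<or> q \<le> v (Suc n)" by blast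
    then have n: "q \<le> u (Suc n) \<or> q \<le> v (Suc n)" unfolding n_def by (rule LeastI_ex)
    have "n0 \<le> n"
    proof (rule ccontr)
      assume "\<not> n0 \<le> n"
      then have "u (Suc n) \<le> u n0" "v (Suc n) \<le> v n0" using mono by (simp_all add: monoD)
      then show False using n q(1) by linarith
    qed
    have less: "u n < q" "v n < q"
    proof -
      have "u n < q \<and> v n < q"
      proof (cases "n = n0")
        case True
        then show ?thesis using q(1) by simp
      next
        case False
        then obtain m where "n = Suc m" using \<open>n0 \<le> n\<close> by (cases n) auto
        then show ?thesis using not_less_Least[of m "\<lambda>n. q \<le> u (Suc n) \<or> q \<le> v (Suc n)"] n_def by auto
      qed
      then show "u n < q" "v n < q" by auto
    qed
    show False
    proof (cases "q \<le> u (Suc n)")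
      case True
      then have "frac (real q * \<alpha>) + frac (real (v n) * \<alpha>) < 1"
        using less by (intro frac_add u[rule_format]) auto
      then show False using q(2)[of "v n"] n0[OF \<open>n0 \<le> n\<close>] less by linarith
    next
      case False
      then have "frac (real (u (Suc n)) * \<alpha>) + frac (real q * \<alpha>) < 1"
        using less n by (intro frac_add v[rule_format]) auto
      then show False using q(2)[of "u (Suc n)"] n0[of "Suc n"] \<open>n0 \<le> n\<close> False by linarith
    qed
  qed
  show ?thesis
  proof (cases s)
    case True
    then show ?thesis using lower assms by simp
  next
    case False
    have "1 - \<alpha> \<notin> \<rat>" using assms(3) Rats_diff[OF Rats_1, of "1 - \<alpha>"] by auto
    then have "\<not> self_shuffling (coding True (1 - \<alpha>) 0)" using lower assms by simp
    then show ?thesis using self_shuffling_complement[OF assms(1,2), of s 0] False by simp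
  qed
qed

section \<open>Slope and intercept are determined by the word\<close>

text \<open>
  The number of ones in a prefix of length \<open>n\<close> differs from \<open>n\<alpha>\<close> by at most 1.
\<close>

lemma coding_slope_unique:
  assumes "0 < \<alpha>" "\<alpha> < 1" "0 < \<beta>" "\<beta> < 1" and eq: "coding s \<alpha> \<rho> = coding s' \<beta> \<sigma>"
  shows "\<alpha> = \<beta>"
proof (rule ccontr)
  assume "\<alpha> \<noteq> \<beta>"
  then obtain n where n: "2 < real n * \<bar>\<alpha> - \<beta>\<bar>"
    using ex_less_of_nat_mult[of "\<bar>\<alpha> - \<beta>\<bar>" 2] by auto
  have "cell s (\<rho> + real n * \<alpha>) - cell s \<rho> = cell s' (\<sigma> + real n * \<beta>) - cell s' \<sigma>"
    using sum_coding[of \<alpha> s \<rho> n] sum_coding[of \<beta> s' \<sigma> n] assms by simp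
  then have "\<bar>real n * \<alpha> - real n * \<beta>\<bar> \<le> 2"
    using cell_bounds[where s = s and t = "\<rho> + real n * \<alpha>"] cell_bounds[where s = s and t = \<rho>]
      cell_bounds[where s = s' and t = "\<sigma> + real n * \<beta>"] cell_bounds[where s = s' and t = \<sigma>] by linarith
  moreover have "\<bar>real n * \<alpha> - real n * \<beta>\<bar> = real n * \<bar>\<alpha> - \<beta>\<bar>"
    by (simp add: abs_mult flip: right_diff_distrib)
  ultimately show False using n by simp
qed

text \<open>
  If the intercepts differ modulo 1, shift one of them by an integer so that the counts agree; some
  rotation then places an integer strictly between the two orbits, where the conventions for the
  end points do not matter, and the counts differ.
\<close>

lemma coding_intercept_unique:
  assumes "0 < \<alpha>" "\<alpha> < 1" "\<alpha> \<notin> \<rat>" and eq: "coding s \<alpha> \<rho> = coding s' \<alpha> \<sigma>"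
  shows "\<rho> - \<sigma> \<in> \<int>"
proof -
  have le: "\<tau> \<le> \<rho>" if "\<And>n. cell s (\<rho> + real n * \<alpha>) = cell s' (\<tau> + real n * \<alpha>)" for s s' \<rho> \<tau>
  proof (rule ccontr)
    assume "\<not> \<tau> \<le> \<rho>"
    then have "0 < (\<tau> - \<rho>) / 2" by simp
    \<comment> \<open>The target is such that the integer \<open>h\<close> ends up near the midpoint of the two orbit points.\<close>
    then obtain h k where k: "k > 0" and hk: "\<bar>of_int k * \<alpha> - of_int h - (- (\<rho> + \<tau>) / 2)\<bar> < (\<tau> - \<rho>) / 2"
      by (rule sequence_of_fractional_parts_is_dense[OF assms(3), where \<alpha> = "- (\<rho> + \<tau>) / 2"])
    have "\<rho> + real (nat k) * \<alpha> < of_int h" "of_int h < \<tau> + real (nat k) * \<alpha>"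
      using k hk by (simp_all add: abs_less_iff field_simps)
    then have "\<not> h \<le> cell s (\<rho> + real (nat k) * \<alpha>)" "h \<le> cell s' (\<tau> + real (nat k) * \<alpha>)"
      unfolding le_cell_iff by auto
    then show False using that by simp
  qed
  define k where "k = cell s \<rho> - cell s' \<sigma>"
  have eq': "cell s (\<rho> + real n * \<alpha>) = cell s' (\<sigma> + of_int k + real n * \<alpha>)" for n
  proof -
    have "\<sigma> + of_int k + real n * \<alpha> = \<sigma> + real n * \<alpha> + of_int k" by simp
    then have "cell s' (\<sigma> + of_int k + real n * \<alpha>) = cell s' (\<sigma> + real n * \<alpha>) + k"
      by (simp only: cell_add_int)
    then show ?thesis
      using sum_coding[OF assms(1,2), of s \<rho> n] sum_coding[OF assms(1,2), of s' \<sigma> n] eq by (simp add: k_def)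
  qed
  have "\<rho> = \<sigma> + of_int k"
    using le[OF eq'] le[OF eq'[symmetric]] by simp
  then show ?thesis by simp
qed

theorem corollary5p2:
  fixes \<alpha> \<rho> :: real and x :: "nat word"
  assumes "sturmian_word \<alpha> \<rho> x"
  shows "(self_shuffling x \<longleftrightarrow> \<rho> \<noteq> 0) \<and>
         (self_shuffling x \<longleftrightarrow>
            \<not> (\<exists>a\<in>{0, 1}. \<exists>C. characteristic_word C \<and> x = a ## C))"
proof -
  from assms obtain s where \<alpha>: "0 < \<alpha>" "\<alpha> < 1" "\<alpha> \<notin> \<rat>" and \<rho>: "0 \<le> \<rho>" "\<rho> < 1"
    and x: "x = coding s \<alpha> \<rho>"
    unfolding sturmian_word_iff by blast
  have shuffle: "self_shuffling x \<longleftrightarrow> \<rho> \<noteq> 0"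
    using self_shuffling_coding[OF \<alpha>, of \<rho> s] not_self_shuffling_coding_0[OF \<alpha>, of s] \<rho> x by force
  have "\<rho> = 0 \<longleftrightarrow> (\<exists>a\<in>{0, 1}. \<exists>C. characteristic_word C \<and> x = a ## C)"
  proof
    assume "\<rho> = 0"
    then have "suffix 1 x = coding s \<alpha> \<alpha>" unfolding x suffix_coding by simp
    then have "characteristic_word (suffix 1 x)"
      unfolding characteristic_word_def sturmian_word_iff using \<alpha> by fastforce
    moreover have "x = x 0 ## suffix 1 x" by (simp add: fun_eq_iff split: nat.split)
    moreover have "x 0 \<in> {0, 1}" using coding_cases[OF \<alpha>(1,2), of s \<rho> 0] x by auto
    ultimately show "\<exists>a\<in>{0, 1}. \<exists>C. characteristic_word C \<and> x = a ## C" by blast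
  next
    assume "\<exists>a\<in>{0, 1}. \<exists>C. characteristic_word C \<and> x = a ## C"
    then obtain a C where C: "characteristic_word C" "x = a ## C" by blast
    from C(1) obtain \<beta> s' where \<beta>: "0 < \<beta>" "\<beta> < 1" "C = coding s' \<beta> \<beta>"
      unfolding characteristic_word_def sturmian_word_iff by blast
    have "suffix 1 x = C" unfolding C(2) by (simp add: fun_eq_iff)
    then have eq: "coding s \<alpha> (\<rho> + \<alpha>) = coding s' \<beta> \<beta>" unfolding x suffix_coding \<beta>(3) .
    then have "\<alpha> = \<beta>" using coding_slope_unique \<alpha> \<beta> by blast
    then have "\<rho> + \<alpha> - \<alpha> \<in> \<int>" using coding_intercept_unique[OF \<alpha>, of s "\<rho> + \<alpha>" s' \<alpha>] eq by simp
    then show "\<rho> = 0" using \<rho> by (auto elim!: Ints_cases)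
  qed
  with shuffle show ?thesis by blast
qed

end
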